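(* Let $R$ be a finite commutative ring with unity $e$ whose set of units $U(R)$ consists of $m$ distinct sets of mutual inverses $\{r_i,r_j\}$, each of order (cardinality) $1$ or $2$. Then $\chi(\Gamma'(R))\in\{1,2\}$, where $\Gamma'(R)$ is the unity product graph associated with $R$.
   Context: A set of mutual inverses is a set $\{r_i,r_j\}\subseteq U(R)$ with $r_i\cdot r_j=e$ (possibly $r_i=r_j$, in which case it has cardinality $1$); thus $m$ is the number of distinct sets $\{r,r^{-1}\}$ with $r\in U(R)$. The unity product graph $\Gamma'(R)$ is the simple graph with vertex set $U(R)$ in which two distinct vertices $r_i,r_j$ are adjacent if and only if $r_i\cdot r_j=e$. $\chi(\Gamma)$ denotes the chromatic number of the graph $\Gamma$, the smallest $k$ such that $\Gamma$ has a (proper vertex) $k$-colouring. *)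

theory Defs
  imports "HOL-Algebra.Ring" "Graph_Theory.Digraph"
begin

definition mutual_inverse_sets :: "('a, 'm) ring_scheme \<Rightarrow> 'a set set" where
  "mutual_inverse_sets R =
     {{r, s} | r s. r \<in> Units R \<and> s \<in> Units R \<and> r \<otimes>\<^bsub>R\<^esub> s = \<one>\<^bsub>R\<^esub>}"

text \<open>
  As usual in \<^theory>\<open>Graph_Theory.Digraph\<close>, a simple graph is a finite symmetric digraph without
  loops and multiple arcs (locale \<^locale>\<open>graph\<close>): an edge between \<open>r\<close> and \<open>s\<close> is represented by
  the two arcs \<open>(r, s)\<close> and \<open>(s, r)\<close>.
\<close>

definition unity_product_graph :: "('a, 'm) ring_scheme \<Rightarrow> ('a, 'a \<times> 'a) pre_digraph" where
  "unity_product_graph R =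
     \<lparr>verts = Units R,
      arcs = {(r, s). r \<in> Units R \<and> s \<in> Units R \<and> r \<noteq> s \<and> r \<otimes>\<^bsub>R\<^esub> s = \<one>\<^bsub>R\<^esub>},
      tail = fst,
      head = snd\<rparr>"

lemma graph_unity_product_graph:
  fixes R :: "('a, 'm) ring_scheme" (structure)
  assumes "cring R" and "finite (carrier R)"
  shows "graph (unity_product_graph R)"
proof -
  interpret cring R by fact
  have sub: "Units R \<subseteq> carrier R" by auto
  then have fin: "finite (Units R)" using assms(2) finite_subset by blast
  have "finite {(r, s). r \<in> Units R \<and> s \<in> Units R \<and> r \<noteq> s \<and> r \<otimes> s = \<one>}"
    by (rule finite_subset[OF _ finite_cartesian_product[OF fin fin]]) auto
  with fin show ?thesis
    using sub by unfold_locales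
      (auto simp: unity_product_graph_def arc_to_ends_def symmetric_conv m_comm subset_eq)
qed

definition proper_colouring :: "('v, 'b) pre_digraph \<Rightarrow> nat \<Rightarrow> ('v \<Rightarrow> nat) \<Rightarrow> bool" where
  "proper_colouring G k c \<longleftrightarrow>
     c ` verts G \<subseteq> {..<k} \<and> (\<forall>u v. u \<rightarrow>\<^bsub>G\<^esub> v \<longrightarrow> c u \<noteq> c v)"

text \<open>
  The following is meaningful only if some finite number of colours suffices, which is the case
  for every graph in the sense of \<^locale>\<open>graph\<close>; otherwise the value is unspecified.
\<close>

definition chromatic_number :: "('v, 'b) pre_digraph \<Rightarrow> nat" where
  "chromatic_number G = (LEAST k. \<exists>c. proper_colouring G k c)"

end

theory Submission
  imports Defs
begin

text \<open>
  A unit of a commutative ring has exactly one inverse, so a vertex \<open>r\<close> of the unity product graph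
  has no neighbour other than \<open>inv r\<close>: the graph is a matching together with isolated vertices
  (the self-inverse units). Singling out one element of every set \<open>{r, inv r}\<close> and colouring it
  differently from the other one gives a proper 2-colouring. Conversely, since \<open>\<one>\<close> is a unit, the
  graph has a vertex, so at least one colour is necessary.
\<close>

lemma unity_product_graph_dominates_iff:
  "u \<rightarrow>\<^bsub>unity_product_graph R\<^esub> v \<longleftrightarrow>
     u \<in> Units R \<and> v \<in> Units R \<and> u \<noteq> v \<and> u \<otimes>\<^bsub>R\<^esub> v = \<one>\<^bsub>R\<^esub>"
  by (force simp: unity_product_graph_def arcs_ends_def arc_to_ends_def)

lemma proper_2_colouring_unity_product_graph:
  fixes R :: "('a, 'm) ring_scheme" (structure)
  assumes "cring R"
  shows "\<exists>c. proper_colouring (unity_product_graph R) 2 c"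
proof -
  interpret cring R by fact
  define rep where "rep r = (SOME x. x \<in> {r, inv r})" for r
  define c :: "'a \<Rightarrow> nat" where "c r = (if r = rep r then 0 else 1)" for r
  have "c u \<noteq> c v" if uv: "u \<rightarrow>\<^bsub>unity_product_graph R\<^esub> v" for u v
  proof -
    have unit: "u \<in> Units R" and ne: "u \<noteq> v" and v: "v = inv u"
      using uv comm_inv_char[of u v] by (auto simp: unity_product_graph_dominates_iff)
    have "{v, inv v} = {u, inv u}"
      using unit by (auto simp: v)
    \<comment> \<open>The choice depends only on the set, so \<open>u\<close> and \<open>v\<close> agree on it, and exactly one of them is
      the chosen element.\<close>
    then have "rep v = rep u"
      by (simp add: rep_def)
    moreover have "rep u \<in> {u, v}"
      unfolding rep_def v by (rule someI) blast
    ultimately show ?thesis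
      using ne by (auto simp: c_def)
  qed
  moreover have "c ` verts (unity_product_graph R) \<subseteq> {..<2}"
    by (auto simp: c_def)
  ultimately show ?thesis
    unfolding proper_colouring_def by blast
qed

lemma not_proper_0_colouring:
  assumes "verts G \<noteq> {}"
  shows "\<not> proper_colouring G 0 c"
  using assms by (simp add: proper_colouring_def)

theorem theorem5p5:
  fixes R :: "('a, 'm) ring_scheme" and m :: nat
  assumes "cring R" and "finite (carrier R)"
    and "Units R = \<Union> (mutual_inverse_sets R)"
    and "card (mutual_inverse_sets R) = m"
    and "\<forall>S \<in> mutual_inverse_sets R. card S \<in> {1, 2}"
  shows "chromatic_number (unity_product_graph R) \<in> {1, 2}"
proof -
  let ?G = "unity_product_graph R"
  interpret cring R by fact
  note two = proper_2_colouring_unity_product_graph[OF \<open>cring R\<close>]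
  have "chromatic_number ?G \<le> 2"
    unfolding chromatic_number_def using two by (rule Least_le)
  moreover have "\<exists>c. proper_colouring ?G (chromatic_number ?G) c"
    unfolding chromatic_number_def using two by (rule LeastI)
  moreover have "verts ?G \<noteq> {}"
    using Units_one_closed by (auto simp: unity_product_graph_def)
  ultimately have "chromatic_number ?G \<noteq> 0"
    using not_proper_0_colouring by metis
  with \<open>chromatic_number ?G \<le> 2\<close> show ?thesis
    by auto
qed

end
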